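(* Let $p$ be an odd prime and $x\in\mathbb{Z}$, and let $A_k(x)=\sum_{j=0}^{k}\binom{k}{j}^2\binom{k+j}{j}^2x^j$ for $k\ge0$. Then $$\frac{1}{p}\sum_{k=0}^{p-1}(-1)^k(2k+1)A_k(x)\equiv\sum_{k=0}^{p-1}\binom{2k}{k}x^k\pmod{p^2}.$$ *)

theory Defs
  imports Complex_Main "HOL-Number_Theory.Number_Theory"
begin

definition apery_poly :: "nat \<Rightarrow> int \<Rightarrow> int" where
  "apery_poly k x =
     (\<Sum>j=0..k. int (k choose j) ^ 2 * int ((k + j) choose j) ^ 2 * x ^ j)"

end

theory Submission
  imports Defs
begin

text \<open>
  Write \<open>b\<^sub>m(k) = (k choose m) (k+m choose m)\<close>. As a function of \<open>k\<close> this is a polynomial in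
  \<open>k (k + 1)\<close> with \<open>(m+1)\<^sup>2 b\<^sub>m\<^sub>+\<^sub>1 = (k (k+1) - m (m+1)) b\<^sub>m\<close>, and this recurrence linearises the
  product: \<open>b\<^sub>j\<^sup>2\<close> is the sum of \<open>(m choose j)\<^sup>2 (2j choose m) b\<^sub>m\<close>. The sums of
  \<open>(-1)\<^sup>k (2k+1) b\<^sub>m(k)\<close> over \<open>k < n\<close> telescope to \<open>(-1)\<^sup>n\<^sup>-\<^sup>1 n (n-1 choose m) (n+m choose m)\<close>, and
  for \<open>n = p\<close> the product of the two binomials is that of the numbers \<open>(p\<^sup>2 - i\<^sup>2) / i\<^sup>2\<close> with
  \<open>1 \<le> i \<le> m\<close>, which is \<open>(-1)\<^sup>m\<close> modulo \<open>p\<^sup>2\<close>. The coefficient of \<open>x\<^sup>j\<close> is then the sum over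
  \<open>m < p\<close> of \<open>(-1)\<^sup>m (m choose j)\<^sup>2 (2j choose m)\<close>. The terms with \<open>p \<le> m \<le> 2j\<close> are divisible by
  \<open>p\<^sup>2\<close>, because \<open>p\<close> divides \<open>m choose j\<close>, and the sum over all \<open>m\<close> is \<open>2j choose j\<close>.
\<close>

section \<open>Recurrences for binomial coefficients with integer factors\<close>

lemma Suc_times_binomial_Suc_int:
  "(int m + 1) * int (n choose Suc m) = (int n - int m) * int (n choose m)"
proof (cases "m \<le> n")
  case True
  have "Suc m * (n choose Suc m) = (n - m) * (n choose m)"
    by (metis binomial_absorb_comp binomial_absorption)
  then have "int (Suc m * (n choose Suc m)) = int ((n - m) * (n choose m))"
    by simp
  with True show ?thesis
    by (simp add: of_nat_diff algebra_simps)
qed (simp add: binomial_eq_0)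

lemma Suc_minus_times_binomial_Suc_int:
  "(int n + 1 - int m) * int (Suc n choose m) = (int n + 1) * int (n choose m)"
proof (cases "m \<le> Suc n")
  case True
  have "(Suc n - m) * (Suc n choose m) = Suc n * (n choose m)"
    using binomial_absorb_comp[of "Suc n" m] by simp
  then have "int (Suc n - m) * int (Suc n choose m) = int (Suc n) * int (n choose m)"
    by (metis of_nat_mult)
  moreover have "int (Suc n - m) = int n + 1 - int m"
    using True by (simp add: of_nat_diff)
  ultimately show ?thesis
    by (simp add: add.commute del: binomial_Suc_Suc)
qed (simp add: binomial_eq_0)

section \<open>The products \<open>b\<^sub>m(k)\<close> and their linearisation\<close>

definition binomial_pair :: "nat \<Rightarrow> nat \<Rightarrow> int" where
  "binomial_pair k m = int (k choose m) * int ((k + m) choose m)"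

lemma binomial_pair_0 [simp]: "binomial_pair k 0 = 1"
  by (simp add: binomial_pair_def)

lemma binomial_pair_eq_0: "k < m \<Longrightarrow> binomial_pair k m = 0"
  by (simp add: binomial_pair_def)

lemma binomial_pair_Suc:
  "(int m + 1)\<^sup>2 * binomial_pair k (Suc m)
     = (int k * (int k + 1) - int m * (int m + 1)) * binomial_pair k m"
proof -
  have "int (Suc m * (Suc (k + m) choose Suc m)) = int (Suc (k + m) * ((k + m) choose m))"
    by (simp only: Suc_times_binomial)
  then have 1: "(int m + 1) * int (Suc (k + m) choose Suc m)
      = (int k + int m + 1) * int ((k + m) choose m)"
    by (simp add: algebra_simps del: binomial_Suc_Suc)
  have "(int m + 1)\<^sup>2 * binomial_pair k (Suc m) =
      ((int m + 1) * int (k choose Suc m)) * ((int m + 1) * int (Suc (k + m) choose Suc m))"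
    by (simp add: binomial_pair_def power2_eq_square mult_ac del: binomial_Suc_Suc)
  also have "\<dots> = ((int k - int m) * int (k choose m))
      * ((int k + int m + 1) * int ((k + m) choose m))"
    unfolding 1 by (simp only: Suc_times_binomial_Suc_int)
  finally show ?thesis
    by (simp add: binomial_pair_def algebra_simps)
qed

text \<open>Coefficient of \<open>binomial_pair k m\<close> in the product of the pairs with indices
  j and l. The two indices are kept apart so that j can be raised by induction with l fixed; the
  Apery polynomials use l = j.\<close>

definition pair_coeff :: "nat \<Rightarrow> nat \<Rightarrow> nat \<Rightarrow> int" where
  "pair_coeff j l m = int (m choose j) * int (m choose l) * int ((j + l) choose m)"

lemma pair_coeff_Suc_0: "pair_coeff (Suc j) l 0 = 0"
  by (simp add: pair_coeff_def)

text \<open>This is the comparison of coefficients that arises when the expansion for j is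
  multiplied by k(k+1) - j(j+1).\<close>

lemma pair_coeff_Suc_Suc:
  "(int j + 1)\<^sup>2 * pair_coeff (Suc j) l (Suc m) = (int m + 1)\<^sup>2 * pair_coeff j l m
     + ((int m + 1) * (int m + 2) - int j * (int j + 1)) * pair_coeff j l (Suc m)"
proof -
  let ?n = "Suc m"
  define A B U V where "A = int (?n choose j)" and "B = int (?n choose l)"
    and "U = int ((j + l) choose m)" and "V = int ((j + l) choose ?n)"
  have a: "(int j + 1) * int (?n choose Suc j) = (int m + 1 - int j) * A"
    using Suc_times_binomial_Suc_int[of j ?n] by (simp add: A_def algebra_simps del: binomial_Suc_Suc)
  have b: "(int m + 1) * int (m choose j) = (int m + 1 - int j) * A"
    "(int m + 1) * int (m choose l) = (int m + 1 - int l) * B"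
    by (simp_all only: Suc_minus_times_binomial_Suc_int A_def B_def)
  have c: "(int m + 1) * V = (int j + int l - int m) * U"
    using Suc_times_binomial_Suc_int[of m "j + l"] by (simp add: U_def V_def)
  have "(int j + 1)\<^sup>2 * pair_coeff (Suc j) l ?n
      = ((int j + 1) * int (?n choose Suc j)) * B * ((int j + 1) * (U + V))"
    by (simp add: pair_coeff_def power2_eq_square B_def U_def V_def algebra_simps)
  also have "\<dots> = (int m + 1 - int j) * A * B * ((int j + 1) * (U + V))"
    by (simp only: a)
  \<comment> \<open>U + V comes from Pascal's rule. Fact \<open>c\<close> trades (j+l-m) U for (m+1)
    V, chosen so that (m+1-j)(m+j+2) = (m+1)(m+2) - j(j+1) appears in front of V.\<close>
  also have "(int j + 1) * (U + V) = (int m + 1 - int l) * U + (int m + int j + 2) * V"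
    using c by (simp add: algebra_simps)
  also have "(int m + 1 - int j) * A * B * \<dots>
      = ((int m + 1 - int j) * A) * ((int m + 1 - int l) * B) * U
        + ((int m + 1) * (int m + 2) - int j * (int j + 1)) * (A * B * V)"
    by (simp add: algebra_simps)
  also have "\<dots> = (int m + 1)\<^sup>2 * pair_coeff j l m
     + ((int m + 1) * (int m + 2) - int j * (int j + 1)) * pair_coeff j l ?n"
    unfolding b[symmetric]
    by (simp add: pair_coeff_def power2_eq_square A_def B_def U_def V_def mult_ac del: binomial_Suc_Suc)
  finally show ?thesis .
qed

lemma binomial_pair_mult:
  "binomial_pair k j * binomial_pair k l = (\<Sum>m\<le>k. pair_coeff j l m * binomial_pair k m)"
proof (induction j)
  case 0
  \<comment> \<open>Here the coefficient is (m choose l)(l choose m), which vanishes unless m =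
    l.\<close>
  have "(\<Sum>m\<le>k. pair_coeff 0 l m * binomial_pair k m)
      = (\<Sum>m\<le>k. if m = l then binomial_pair k m else 0)"
    by (rule sum.cong) (auto simp: pair_coeff_def)
  then show ?case
    by (simp add: binomial_pair_eq_0)
next
  case (Suc j)
  let ?b = "binomial_pair k" and ?a = "pair_coeff j l"
  define K where "K = int k * (int k + 1)"
  have rec: "(int m + 1)\<^sup>2 * ?b (Suc m) = (K - int m * (int m + 1)) * ?b m" for m
    by (simp add: K_def binomial_pair_Suc)
  have "(int j + 1)\<^sup>2 * (?b (Suc j) * ?b l) = (K - int j * (int j + 1)) * (?b j * ?b l)"
    by (simp only: mult.assoc[symmetric] rec)
  also have "\<dots> = (\<Sum>m\<le>k. ?a m * ((K - int j * (int j + 1)) * ?b m))"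
    unfolding Suc.IH sum_distrib_left by (simp only: mult_ac)
  \<comment> \<open>Split K - j(j+1) as (K - m(m+1)) + (m(m+1) - j(j+1)); the recurrence turns the
    first part into a multiple of \<open>?b (Suc m)\<close>.\<close>
  also have "\<dots> = (\<Sum>m\<le>k. (int m + 1)\<^sup>2 * ?a m * ?b (Suc m)
      + (int m * (int m + 1) - int j * (int j + 1)) * ?a m * ?b m)"
  proof (rule sum.cong)
    fix m
    have "(K - int j * (int j + 1)) * ?b m
        = (int m + 1)\<^sup>2 * ?b (Suc m) + (int m * (int m + 1) - int j * (int j + 1)) * ?b m"
      unfolding rec by (simp add: algebra_simps)
    then show "?a m * ((K - int j * (int j + 1)) * ?b m) = (int m + 1)\<^sup>2 * ?a m * ?b (Suc m)
      + (int m * (int m + 1) - int j * (int j + 1)) * ?a m * ?b m"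
      by (simp add: distrib_left mult_ac)
  qed simp
  \<comment> \<open>The second sum gains the zero term at m = k+1, so that after an index shift both
    sums run over the same range.\<close>
  also have "\<dots> = (\<Sum>m<Suc k. (int m + 1)\<^sup>2 * ?a m * ?b (Suc m))
      + (\<Sum>m<Suc (Suc k). (int m * (int m + 1) - int j * (int j + 1)) * ?a m * ?b m)"
    unfolding sum.distrib
    by (simp add: binomial_pair_eq_0 lessThan_Suc_atMost[symmetric] del: sum.lessThan_Suc)
       (simp add: binomial_pair_eq_0)
  also have "\<dots> = - (int j * (int j + 1)) * ?a 0 + (\<Sum>m<Suc k. ((int m + 1)\<^sup>2 * ?a m
      + ((int m + 1) * (int m + 2) - int j * (int j + 1)) * ?a (Suc m)) * ?b (Suc m))"
    unfolding sum.lessThan_Suc_shift[of _ "Suc k"]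
    by (simp add: sum.distrib distrib_right add_ac del: sum.lessThan_Suc)
  \<comment> \<open>For j = 0 the factor is zero, for j > 0 the coefficient is.\<close>
  also have "- (int j * (int j + 1)) * ?a 0 = 0"
    by (cases j) (simp_all add: pair_coeff_def)
  also have "(\<Sum>m<Suc k. ((int m + 1)\<^sup>2 * ?a m
      + ((int m + 1) * (int m + 2) - int j * (int j + 1)) * ?a (Suc m)) * ?b (Suc m))
      = (int j + 1)\<^sup>2 * (\<Sum>m<Suc k. pair_coeff (Suc j) l (Suc m) * ?b (Suc m))"
    unfolding pair_coeff_Suc_Suc[symmetric] sum_distrib_left by (simp only: mult_ac)
  finally have "(int j + 1)\<^sup>2 * (?b (Suc j) * ?b l)
      = (int j + 1)\<^sup>2 * (\<Sum>m<Suc (Suc k). pair_coeff (Suc j) l m * ?b m)"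
    unfolding sum.lessThan_Suc_shift[of _ "Suc k"]
    by (simp add: pair_coeff_Suc_0 del: sum.lessThan_Suc)
  then have "?b (Suc j) * ?b l = (\<Sum>m<Suc (Suc k). pair_coeff (Suc j) l m * ?b m)"
    by (simp del: sum.lessThan_Suc)
  then show ?case
    by (simp add: binomial_pair_eq_0 lessThan_Suc_atMost[symmetric])
qed

section \<open>Alternating sums over k\<close>

lemma sum_alternating_binomial_pair:
  "(\<Sum>k\<le>n. (-1) ^ k * (2 * int k + 1) * binomial_pair k m)
     = (-1) ^ n * (int n + 1) * (int (n choose m) * int ((Suc n + m) choose m))"
proof (induction n)
  case 0
  then show ?case by (cases m) (simp_all add: binomial_pair_def)
next
  case (Suc n)
  define X Y where "X = int ((Suc n + m) choose m)" and "Y = int (Suc n choose m)"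
  have 1: "(int n + 1) * int (n choose m) = (int n + 1 - int m) * Y"
    by (simp only: Y_def Suc_minus_times_binomial_Suc_int)
  have 2: "(int n + 2) * int ((Suc (Suc n) + m) choose m) = (int n + 2 + int m) * X"
    using Suc_minus_times_binomial_Suc_int[of "Suc n + m" m]
    by (simp add: X_def algebra_simps del: binomial_Suc_Suc)
  have "(\<Sum>k\<le>Suc n. (-1) ^ k * (2 * int k + 1) * binomial_pair k m)
      = (-1) ^ n * ((int n + 1) * int (n choose m)) * X + (-1) ^ Suc n * (2 * int n + 3) * (Y * X)"
    unfolding sum.atMost_Suc Suc.IH
    by (simp add: binomial_pair_def X_def Y_def algebra_simps del: binomial_Suc_Suc)
  \<comment> \<open>The telescoping rests on (n+1-m) - (2n+3) = -(n+2+m).\<close>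
  also have "\<dots> = (-1) ^ Suc n * ((int n + 2 + int m) * X) * Y"
    unfolding 1 by (simp add: algebra_simps)
  also have "\<dots> = (-1) ^ Suc n * (int (Suc n) + 1) * (Y * int ((Suc (Suc n) + m) choose m))"
    unfolding 2[symmetric] by (simp add: algebra_simps del: binomial_Suc_Suc)
  finally show ?case
    by (simp only: Y_def)
qed

lemma sum_alternating_apery_poly:
  "(\<Sum>k\<le>n. (-1) ^ k * (2 * int k + 1) * apery_poly k x)
     = (-1) ^ n * (int n + 1) * (\<Sum>j\<le>n. \<Sum>m\<le>n.
         int (n choose m) * int ((Suc n + m) choose m) * pair_coeff j j m * x ^ j)"
proof -
  \<comment> \<open>Zero terms extend both ranges to n; they no longer depend on k, and the sums can
    be exchanged.\<close>
  have ap: "apery_poly k x = (\<Sum>j\<le>n. \<Sum>m\<le>n. pair_coeff j j m * binomial_pair k m * x ^ j)"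
    if "k \<le> n" for k
  proof -
    have "apery_poly k x = (\<Sum>j\<le>k. binomial_pair k j * binomial_pair k j * x ^ j)"
      unfolding apery_poly_def binomial_pair_def
      by (simp add: power2_eq_square mult_ac atLeast0AtMost)
    also have "\<dots> = (\<Sum>j\<le>n. binomial_pair k j * binomial_pair k j * x ^ j)"
      using that by (intro sum.mono_neutral_left) (auto simp: binomial_pair_eq_0)
    also have "\<dots> = (\<Sum>j\<le>n. (\<Sum>m\<le>n. pair_coeff j j m * binomial_pair k m) * x ^ j)"
      unfolding binomial_pair_mult using that
      by (intro sum.cong refl arg_cong2[of _ _ _ _ "(*)"] sum.mono_neutral_left)
         (auto simp: binomial_pair_eq_0)
    finally show ?thesis by (simp add: sum_distrib_right)
  qed
  have "(\<Sum>k\<le>n. (-1) ^ k * (2 * int k + 1) * apery_poly k x)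
      = (\<Sum>k\<le>n. \<Sum>j\<le>n. \<Sum>m\<le>n. (pair_coeff j j m * x ^ j)
          * ((-1) ^ k * (2 * int k + 1) * binomial_pair k m))"
    by (intro sum.cong refl) (simp add: ap sum_distrib_left mult_ac)
  also have "\<dots> = (\<Sum>j\<le>n. \<Sum>k\<le>n. \<Sum>m\<le>n. (pair_coeff j j m * x ^ j)
          * ((-1) ^ k * (2 * int k + 1) * binomial_pair k m))"
    by (rule sum.swap)
  also have "\<dots> = (\<Sum>j\<le>n. \<Sum>m\<le>n. \<Sum>k\<le>n. (pair_coeff j j m * x ^ j)
          * ((-1) ^ k * (2 * int k + 1) * binomial_pair k m))"
    by (intro sum.cong refl sum.swap)
  also have "\<dots> = (\<Sum>j\<le>n. \<Sum>m\<le>n. (pair_coeff j j m * x ^ j)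
      * ((-1) ^ n * (int n + 1) * (int (n choose m) * int ((Suc n + m) choose m))))"
    by (simp only: sum_distrib_left[symmetric] sum_alternating_binomial_pair)
  finally show ?thesis
    by (simp only: sum_distrib_left mult_ac)
qed

section \<open>Finite differences and the full sum over m\<close>

lemma sum_alternating_binomial_shift:
  "(\<Sum>i\<le>n. (-1) ^ i * int (n choose i) * int ((a + i) choose (n + s))) = (-1) ^ n * int (a choose s)"
proof (induction n arbitrary: s)
  case 0
  then show ?case by simp
next
  case (Suc n)
  let ?f = "\<lambda>i. int ((a + i) choose (Suc n + s))"
  have "(\<Sum>i\<le>Suc n. (-1) ^ i * int (Suc n choose i) * ?f i)
      = ?f 0 + (\<Sum>i\<le>n. (-1) ^ Suc i * int (Suc n choose Suc i) * ?f (Suc i))"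
    by (simp add: sum.atMost_Suc_shift del: sum.atMost_Suc binomial_Suc_Suc)
  also have "\<dots> = ?f 0 + (\<Sum>i\<le>n. (-1) ^ Suc i * int (n choose Suc i) * ?f (Suc i))
      + (\<Sum>i\<le>n. (-1) ^ Suc i * int (n choose i) * ?f (Suc i))"
    by (simp add: sum.distrib[symmetric] algebra_simps)
  also have "?f 0 + (\<Sum>i\<le>n. (-1) ^ Suc i * int (n choose Suc i) * ?f (Suc i))
      = (\<Sum>i\<le>Suc n. (-1) ^ i * int (n choose i) * ?f i)"
    by (simp add: sum.atMost_Suc_shift del: sum.atMost_Suc)
  also have "\<dots> = (\<Sum>i\<le>n. (-1) ^ i * int (n choose i) * ?f i)"
    by simp
  \<comment> \<open>Pascal's rule: each difference in the upper argument lowers the lower index by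
    one. The whole sum is, up to sign, an n-th finite difference.\<close>
  also have "\<dots> + (\<Sum>i\<le>n. (-1) ^ Suc i * int (n choose i) * ?f (Suc i))
      = - (\<Sum>i\<le>n. (-1) ^ i * int (n choose i) * int ((a + i) choose (n + s)))"
    by (simp add: sum.distrib[symmetric] sum_negf[symmetric] algebra_simps)
  finally show ?case
    by (simp add: Suc.IH)
qed

text \<open>Terms with m < j vanish. For m = i + j, trinomial revision extracts the factor (2j
  choose j) and leaves the finite difference sum with s = 0, whose value is (-1)^j.\<close>

lemma sum_alternating_pair_coeff:
  "(\<Sum>m\<le>2 * j. (-1) ^ m * pair_coeff j j m) = int ((2 * j) choose j)"
proof -
  have "(\<Sum>m\<le>2 * j. (-1) ^ m * pair_coeff j j m) = (\<Sum>m=j..2 * j. (-1) ^ m * pair_coeff j j m)"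
    by (rule sum.mono_neutral_right) (auto simp: pair_coeff_def not_le)
  also have "\<dots> = (\<Sum>i\<le>j. (-1) ^ (i + j) * pair_coeff j j (i + j))"
    using sum.shift_bounds_cl_nat_ivl[of "\<lambda>m. (-1) ^ m * pair_coeff j j m" 0 j j]
    by (simp add: mult_2 atLeast0AtMost)
  also have "\<dots> = (\<Sum>i\<le>j. (-1) ^ j * int ((2 * j) choose j)
      * ((-1) ^ i * int (j choose i) * int ((j + i) choose (j + 0))))"
  proof (rule sum.cong)
    fix i assume "i \<in> {..j}"
    then have "((2 * j) choose (i + j)) * ((i + j) choose j) = ((2 * j) choose j) * (j choose i)"
      using choose_mult[of j "i + j" "2 * j"] by simp
    then have "int ((i + j) choose j) * int ((2 * j) choose (i + j))
        = int ((2 * j) choose j) * int (j choose i)"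
      by (metis of_nat_mult mult.commute)
    then show "(-1) ^ (i + j) * pair_coeff j j (i + j) = (-1) ^ j * int ((2 * j) choose j)
        * ((-1) ^ i * int (j choose i) * int ((j + i) choose (j + 0)))"
      by (simp add: pair_coeff_def power_add mult_2[symmetric] add.commute[of j i])
  qed simp
  also have "\<dots> = (-1) ^ j * int ((2 * j) choose j) * (-1) ^ j"
    unfolding sum_distrib_left[symmetric] sum_alternating_binomial_shift by simp
  finally show ?thesis
    by (simp add: power_mult_distrib[symmetric] mult_ac)
qed

section \<open>Congruences modulo the square of a prime\<close>

context
  fixes p :: nat
  assumes prime: "prime p"
begin

lemma cong_binomial_prime_pred:
  "m < p \<Longrightarrow> [int ((p - 1) choose m) * int ((p + m) choose m) = (-1) ^ m] (mod (int p)\<^sup>2)"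
proof (induction m)
  case 0
  then show ?case by simp
next
  case (Suc m)
  define B where "B i = int ((p - 1) choose i) * int ((p + i) choose i)" for i
  have pos: "p \<ge> 1" using Suc.prems by simp
  have "int (Suc m * (Suc (p + m) choose Suc m)) = int (Suc (p + m) * ((p + m) choose m))"
    by (simp only: Suc_times_binomial)
  then have 1: "(int m + 1) * int (Suc (p + m) choose Suc m)
      = (int p + (int m + 1)) * int ((p + m) choose m)"
    by (simp add: algebra_simps del: binomial_Suc_Suc)
  have 2: "(int m + 1) * int ((p - 1) choose Suc m)
      = (int p - (int m + 1)) * int ((p - 1) choose m)"
    using Suc_times_binomial_Suc_int[of m "p - 1"] pos by (simp add: of_nat_diff algebra_simps)
  have "(int m + 1)\<^sup>2 * B (Suc m) = ((int m + 1) * int ((p - 1) choose Suc m))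
      * ((int m + 1) * int (Suc (p + m) choose Suc m))"
    by (simp add: B_def power2_eq_square mult_ac del: binomial_Suc_Suc)
  also have "\<dots> = ((int p)\<^sup>2 - (int m + 1)\<^sup>2) * B m"
    unfolding 1 2 B_def by (simp add: algebra_simps power2_eq_square)
  also have "[\<dots> = (0 - (int m + 1)\<^sup>2) * (-1) ^ m] (mod (int p)\<^sup>2)"
    using Suc unfolding B_def
    by (intro cong_mult cong_diff cong_refl) (simp_all add: cong_0_iff)
  also have "(0 - (int m + 1)\<^sup>2) * (-1) ^ m = (int m + 1)\<^sup>2 * (-1) ^ Suc m"
    by simp
  finally have *: "[(int m + 1)\<^sup>2 * B (Suc m) = (int m + 1)\<^sup>2 * (-1) ^ Suc m] (mod (int p)\<^sup>2)" .
  \<comment> \<open>As 0 < m+1 < p, the factor (m+1)^2 is invertible modulo p^2 and can be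
    cancelled.\<close>
  have "coprime (Suc m) p"
    using prime Suc.prems by (metis coprime_commute nat_dvd_not_less prime_imp_coprime zero_less_Suc)
  then have "coprime (int (Suc m)) (int p)"
    by (simp only: coprime_int_iff)
  then have "coprime (int m + 1) (int p)"
    by (simp only: of_nat_Suc add.commute)
  then have "coprime ((int m + 1)\<^sup>2) ((int p)\<^sup>2)"
    by simp
  then show ?case
    using * cong_mult_lcancel unfolding B_def by blast
qed

text \<open>The prime divides m! but neither j! nor (m-j)!.\<close>

lemma prime_dvd_binomial:
  assumes "j < p" "p \<le> m" "m - j < p"
  shows "p dvd (m choose j)"
proof -
  have "p dvd fact m"
    using prime assms by (simp add: prime_dvd_fact_iff)
  moreover have "fact m = fact j * fact (m - j) * (m choose j)"
    using assms binomial_fact_lemma[of j m] by simp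
  moreover have "\<not> p dvd fact j" "\<not> p dvd fact (m - j)"
    using prime assms by (simp_all add: prime_dvd_fact_iff)
  ultimately show ?thesis
    using prime by (simp add: prime_dvd_mult_iff)
qed

lemma cong_sum_alternating_pair_coeff:
  assumes "j < p"
  shows "[(\<Sum>m\<le>p - 1. (-1) ^ m * pair_coeff j j m) = int ((2 * j) choose j)] (mod (int p)\<^sup>2)"
proof -
  let ?f = "\<lambda>m. (-1) ^ m * pair_coeff j j m"
  have split: "{..2 * (p - 1)} = {..p - 1} \<union> {p..2 * (p - 1)}" "{..p - 1} \<inter> {p..2 * (p - 1)} = {}"
    using assms by auto
  \<comment> \<open>The common bound 2(p-1) is at least 2j, and terms with m > 2j vanish.\<close>
  have "int ((2 * j) choose j) = (\<Sum>m\<le>2 * (p - 1). ?f m)"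
    unfolding sum_alternating_pair_coeff[symmetric] using assms
    by (intro sum.mono_neutral_left) (auto simp: pair_coeff_def mult_2[symmetric])
  also have "\<dots> = (\<Sum>m\<le>p - 1. ?f m) + (\<Sum>m=p..2 * (p - 1). ?f m)"
    unfolding split(1) by (rule sum.union_disjoint) (use split(2) in auto)
  also have "[\<dots> = (\<Sum>m\<le>p - 1. ?f m) + 0] (mod (int p)\<^sup>2)"
  proof (intro cong_add cong_refl, unfold cong_0_iff, rule dvd_sum)
    fix m assume m: "m \<in> {p..2 * (p - 1)}"
    show "(int p)\<^sup>2 dvd ?f m"
    proof (cases "m \<le> 2 * j")
      case True
      \<comment> \<open>Here m - j is at most j, hence less than p; the squared binomial then
        supplies p^2.\<close>
      with m assms have "p dvd (m choose j)"
        by (intro prime_dvd_binomial) auto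
      then have "int p * int p dvd int (m choose j) * int (m choose j)"
        by (intro mult_dvd_mono) simp_all
      then show ?thesis
        by (simp add: pair_coeff_def power2_eq_square)
    next
      case False
      then show ?thesis by (simp add: pair_coeff_def binomial_eq_0)
    qed
  qed
  finally show ?thesis by (simp add: cong_sym)
qed

end

theorem theorem2p2:
  fixes p :: nat and x :: int
  assumes "prime p" and "odd p"
  shows "int p dvd (\<Sum>k=0..p-1. (-1) ^ k * (2 * int k + 1) * apery_poly k x) \<and>
         [(\<Sum>k=0..p-1. (-1) ^ k * (2 * int k + 1) * apery_poly k x) div int p
            = (\<Sum>k=0..p-1. int ((2 * k) choose k) * x ^ k)] (mod (int p) ^ 2)"
proof -
  have pos: "p > 0" using assms(1) prime_gt_0_nat by blast
  define T where "T = (\<Sum>j\<le>p - 1. \<Sum>m\<le>p - 1.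
    int ((p - 1) choose m) * int ((p + m) choose m) * pair_coeff j j m * x ^ j)"
  \<comment> \<open>With n = p - 1 the factor n + 1 is p, and the sign is 1 because p is odd. This
    gives both the divisibility and the quotient T.\<close>
  have S: "(\<Sum>k=0..p-1. (-1) ^ k * (2 * int k + 1) * apery_poly k x) = int p * T"
    using sum_alternating_apery_poly[where n = "p - 1" and x = x] pos assms(2)
    by (simp add: T_def atLeast0AtMost of_nat_diff)
  have "[T = (\<Sum>j\<le>p - 1. \<Sum>m\<le>p - 1. (-1) ^ m * pair_coeff j j m * x ^ j)] (mod (int p)\<^sup>2)"
    unfolding T_def using pos
    by (intro cong_sum cong_mult cong_refl cong_binomial_prime_pred assms(1)) auto
  also have "(\<Sum>j\<le>p - 1. \<Sum>m\<le>p - 1. (-1) ^ m * pair_coeff j j m * x ^ j)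
      = (\<Sum>j\<le>p - 1. (\<Sum>m\<le>p - 1. (-1) ^ m * pair_coeff j j m) * x ^ j)"
    by (simp only: sum_distrib_right)
  also have "[\<dots> = (\<Sum>j\<le>p - 1. int ((2 * j) choose j) * x ^ j)] (mod (int p)\<^sup>2)"
    using pos
    by (intro cong_sum cong_mult cong_refl cong_sum_alternating_pair_coeff assms(1)) auto
  finally show ?thesis
    using S pos by (simp add: atLeast0AtMost)
qed

end
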